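(* Let $p\in\{0,1\}$, $g\in\mathcal{C}^0\cap\mathcal{D}^p\cap\mathcal{K}^p$, and let $x>0$ be such that $g$ is $p$-convex or $p$-concave on $[x,\infty)$. Then $$\left|\Sigma g\left(x+\tfrac12\right)-\int_x^{x+1}\Sigma g(t)\,dt\right|\le\left|J^{p+1}[\Sigma g](x)\right|\le\overline{G}_p\,|\Delta^pg(x)|.$$ In particular, $$\Sigma g(x)-\int_{x-\frac12}^{x+\frac12}\Sigma g(t)\,dt\ \to\ 0\qquad\text{as }x\to\infty,$$ or equivalently, $$\Sigma g(x)-\int_1^{x-\frac12}g(t)\,dt\ \to\ \sigma[g]\qquad\text{as }x\to\infty.$$
   Context: $\mathbb{R}_+=(0,\infty)$, $\Delta f(x)=f(x+1)-f(x)$; $\mathcal{C}^0$ is the set of continuous functions $\mathbb{R}_+\to\mathbb{R}$. A function on an interval is $0$-convex (resp. $0$-concave) if it is increasing (resp. decreasing) in the wide sense, and $1$-convex (resp. $1$-concave) if it is convex (resp. concave) in the usual sense. $\mathcal{K}^p$ is the set of functions $\mathbb{R}_+\to\mathbb{R}$ that are $p$-convex on some $[a,\infty)$ or $p$-concave on some $[a,\infty)$. $\mathcal{D}^p$ is the set of $g\colon\mathbb{R}_+\to\mathbb{R}$ with $\Delta^pg(n)\to 0$ as $n\to\infty$ over the integers. For $g\in\mathcal{D}^p\cap\mathcal{K}^p$, the function $\Sigma g\colon\mathbb{R}_+\to\mathbb{R}$ is $$\Sigma g(x)=\lim_{n\to\infty}\Big(-g(x)+\sum_{k=1}^{n-1}(g(k)-g(x+k))+\sum_{j=1}^p\binom{x}{j}\Delta^{j-1}g(n)\Big);$$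 the limit exists, does not depend on the choice of such $p$, $\Sigma g$ is the unique solution $f\in\mathcal{K}^p$ of $\Delta f=g$ with $f(1)=0$, and $\Sigma g$ is continuous if $g$ is. $G_n=\int_0^1\binom{t}{n}\,dt$ and $\overline{G}_n=1-\sum_{j=1}^n|G_j|$ (so $\overline{G}_0=1$, $\overline{G}_1=\frac12$). $\sigma[g]=\int_0^1\Sigma g(t+1)\,dt$. For continuous $f$ and $q\in\mathbb{N}$, $J^q[f](x)=\sum_{j=0}^{q-1}G_j\Delta^jf(x)-\int_x^{x+1}f(t)\,dt$. *)

theory Defs
  imports "HOL-Analysis.Analysis"
begin

text \<open>
  Functions on the positive half-line are modelled by total functions of type
  \<open>real \<Rightarrow> real\<close>; values outside \<open>{0<..}\<close> never affect the notions below
  when these are used at positive arguments.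
\<close>

definition Delta :: "(real \<Rightarrow> real) \<Rightarrow> real \<Rightarrow> real" where
  "Delta f x = f (x + 1) - f x"

text \<open>Only the orders 0 and 1 are considered; both predicates are false for larger orders.\<close>

definition p_convex_on :: "nat \<Rightarrow> real set \<Rightarrow> (real \<Rightarrow> real) \<Rightarrow> bool" where
  "p_convex_on p I f \<longleftrightarrow> (p = 0 \<and> mono_on I f) \<or> (p = 1 \<and> convex_on I f)"

definition p_concave_on :: "nat \<Rightarrow> real set \<Rightarrow> (real \<Rightarrow> real) \<Rightarrow> bool" where
  "p_concave_on p I f \<longleftrightarrow> (p = 0 \<and> antimono_on I f) \<or> (p = 1 \<and> concave_on I f)"

definition K_class :: "nat \<Rightarrow> (real \<Rightarrow> real) set" where
  "K_class p = {f. \<exists>a>0. p_convex_on p {a..} f \<or> p_concave_on p {a..} f}"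

definition D_class :: "nat \<Rightarrow> (real \<Rightarrow> real) set" where
  "D_class p = {g. (\<lambda>n. (Delta ^^ p) g (real n)) \<longlonglongrightarrow> 0}"

text \<open>
  The order \<open>p\<close> is an explicit argument. For \<open>g \<in> D_class p \<inter> K_class p\<close> and \<open>x > 0\<close> the limit
  exists and is the same for every such \<open>p\<close>; otherwise the value is unspecified.
\<close>

definition Sigma_fun :: "nat \<Rightarrow> (real \<Rightarrow> real) \<Rightarrow> real \<Rightarrow> real" where
  "Sigma_fun p g x = lim (\<lambda>n::nat.
      - g x + (\<Sum>k=1..n-1. (g (real k) - g (x + real k)))
      + (\<Sum>j=1..p. (x gchoose j) * (Delta ^^ (j - 1)) g (real n)))"

definition Gregory :: "nat \<Rightarrow> real" where
  "Gregory n = integral {0..1} (\<lambda>t::real. t gchoose n)"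

definition Gregory_bar :: "nat \<Rightarrow> real" where
  "Gregory_bar n = 1 - (\<Sum>j=1..n. \<bar>Gregory j\<bar>)"

definition asym_const :: "nat \<Rightarrow> (real \<Rightarrow> real) \<Rightarrow> real" where
  "asym_const p g = integral {0..1} (\<lambda>t. Sigma_fun p g (t + 1))"

definition J_fun :: "nat \<Rightarrow> (real \<Rightarrow> real) \<Rightarrow> real \<Rightarrow> real" where
  "J_fun q f x = (\<Sum>j<q. Gregory j * (Delta ^^ j) f x) - integral {x..x + 1} f"

end

theory Submission
  imports Defs
begin

text \<open>
  Write \<open>f\<close> for \<open>\<Sigma>g\<close>. Everything rests on three properties of \<open>f\<close>: it is continuous on
  \<open>(0,\<infinity>)\<close>, it solves \<open>\<Delta>f = g\<close>, and it is \<open>p\<close>-concave on any half-line where \<open>g\<close> is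
  \<open>p\<close>-convex (and \<open>p\<close>-convex where \<open>g\<close> is \<open>p\<close>-concave).

  The approximants \<open>f\<^sub>n\<close> whose limit is \<open>f\<close> have increments \<open>f\<^sub>n\<^sub>+\<^sub>1 - f\<^sub>n\<close> equal to the error of
  the Newton interpolation of \<open>g\<close> of degree \<open>p\<close> at the nodes \<open>n, \<dots>, n + p\<close>. When \<open>g\<close> is
  eventually \<open>p\<close>-convex, \<open>\<Delta>\<^sup>pg\<close> is eventually monotone, and on \<open>0 < x \<le> m\<close> this error is at
  most \<open>m (\<Delta>\<^sup>pg(n + m) - \<Delta>\<^sup>pg(n - 1))\<close>, which is summable because \<open>\<Delta>\<^sup>pg(n)\<close> converges. So
  \<open>f\<^sub>n \<rightarrow> f\<close> uniformly on bounded sets (lemma \<open>Sigma_limit_and_continuity\<close>), which gives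
  continuity. The other two properties pass to the limit from \<open>f\<^sub>n\<close>
  (lemmas \<open>Delta_Sigma_fun\<close> and \<open>Sigma_fun_p_convex\<close>).

  For \<open>p = 0\<close> the inequalities compare the integral of a monotone function with its values
  at \<open>x\<close>, \<open>x + 1/2\<close>, \<open>x + 1\<close>. For \<open>p = 1\<close>, \<open>J\<^sup>2[f](x)\<close> is the error of the trapezoidal rule;
  the midpoint error has the opposite sign and is no larger, because the trapezoidal rule
  applied to both halves of \<open>[x, x + 1]\<close> is the mean of the midpoint and the trapezoidal rule
  and still errs on the same side as the latter. The extension of the chord over
  \<open>[x + 1, x + 2]\<close> bounds the trapezoidal error by half of the second difference of \<open>f\<close>,
  which is \<open>\<Delta>g\<close>.

  Finally \<open>\<Delta>\<^sup>pg\<close> tends to \<open>0\<close> along the reals, by monotonicity, so the midpoint error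
  vanishes at infinity, and \<open>\<Delta>f = g\<close> turns the integral of \<open>f\<close> over \<open>[y, y + 1]\<close> into
  \<open>\<sigma>[g]\<close> plus the integral of \<open>g\<close> over \<open>[1, y]\<close>.
\<close>

section \<open>Orders of convexity and differences\<close>

lemma Delta_funpow_minus: "(Delta ^^ n) (\<lambda>x. - f x) = (\<lambda>x. - (Delta ^^ n) f x)"
  by (induction n) (auto simp: Delta_def fun_eq_iff)

lemma p_concave_on_iff_p_convex_on_minus:
  "p_concave_on p I g \<longleftrightarrow> p_convex_on p I (\<lambda>x. - g x)"
  by (auto simp: p_concave_on_def p_convex_on_def concave_on_def monotone_on_def)

lemma convex_on_chord_slope_mono:
  fixes g :: "real \<Rightarrow> real"
  assumes "convex_on I g" "u \<in> I" "v \<in> I" "w \<in> I" "z \<in> I"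
    and "u < v" "w < z" "u \<le> w" "v \<le> z"
  shows "(g v - g u) / (v - u) \<le> (g z - g w) / (z - w)"
proof -
  have "(g v - g u) / (v - u) \<le> (g z - g u) / (z - u)"
  proof (cases "v = z")
    case False
    then have "(g u - g v) / (u - v) \<le> (g u - g z) / (u - z)"
      using convex_on_slope_le(1)[of I g u z v] assms by auto
    then show ?thesis by (metis minus_diff_eq minus_divide_divide)
  qed simp
  also have "\<dots> \<le> (g z - g w) / (z - w)"
  proof (cases "u = w")
    case False
    then have "(g u - g z) / (u - z) \<le> (g w - g z) / (w - z)"
      using convex_on_slope_le(2)[of I g u z w] assms by auto
    then show ?thesis by (metis minus_diff_eq minus_divide_divide)
  qed simp
  finally show ?thesis .
qed

text \<open>
  For \<open>p = 1\<close>, \<open>\<Delta>g\<close> is the slope of a chord over a unit interval moving to the right.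
\<close>

lemma p_convex_on_imp_Delta_mono:
  assumes "p_convex_on p {a..} g"
  shows "mono_on {a..} ((Delta ^^ p) g)"
proof (cases "p = 0")
  case True
  then show ?thesis using assms by (simp add: p_convex_on_def)
next
  case False
  then have p: "p = 1" and cvx: "convex_on {a..} g"
    using assms by (auto simp: p_convex_on_def)
  show ?thesis
  proof (rule mono_onI)
    fix r s :: real assume "r \<in> {a..}" "s \<in> {a..}" "r \<le> s"
    then show "(Delta ^^ p) g r \<le> (Delta ^^ p) g s"
      using convex_on_chord_slope_mono[OF cvx, of r "r + 1" s "s + 1"]
      by (simp add: p Delta_def)
  qed
qed

lemma mono_on_tendsto_at_top_of_sequence:
  fixes h :: "real \<Rightarrow> real"
  assumes mono: "mono_on {a..} h" and lim: "(\<lambda>n. h (real n)) \<longlonglongrightarrow> l"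
  shows "(h \<longlongrightarrow> l) at_top"
proof (rule tendsto_sandwich)
  have floor: "filterlim (\<lambda>x::real. nat \<lfloor>x\<rfloor>) sequentially at_top"
    by (rule filterlim_compose[OF filterlim_nat_sequentially filterlim_floor_sequentially])
  show "((\<lambda>x::real. h (real (nat \<lfloor>x\<rfloor>))) \<longlongrightarrow> l) at_top"
    by (rule filterlim_compose[OF lim floor])
  show "((\<lambda>x::real. h (real (Suc (nat \<lfloor>x\<rfloor>)))) \<longlongrightarrow> l) at_top"
    by (rule filterlim_compose[OF LIMSEQ_Suc[OF lim] floor])
  have near: "real (nat \<lfloor>x\<rfloor>) \<le> x \<and> x \<le> real (Suc (nat \<lfloor>x\<rfloor>)) \<and> a \<le> real (nat \<lfloor>x\<rfloor>)"
    if "x \<ge> max 0 (a + 1)" for x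
    using that by linarith
  show "\<forall>\<^sub>F x in at_top. h (real (nat \<lfloor>x\<rfloor>)) \<le> h x"
    using eventually_ge_at_top[of "max 0 (a + 1)"]
  proof eventually_elim
    case (elim x)
    show ?case using near[OF elim] by (intro mono_onD[OF mono]) auto
  qed
  show "\<forall>\<^sub>F x in at_top. h x \<le> h (real (Suc (nat \<lfloor>x\<rfloor>)))"
    using eventually_ge_at_top[of "max 0 (a + 1)"]
  proof eventually_elim
    case (elim x)
    show ?case using near[OF elim] by (intro mono_onD[OF mono]) auto
  qed
qed

text \<open>
  A sequence converging to \<open>0\<close> along the integers does so along the reals once it is
  eventually monotone; this applies to \<open>\<Delta>\<^sup>pg\<close>.
\<close>

lemma Delta_funpow_tendsto_0:
  assumes "g \<in> D_class p" "g \<in> K_class p"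
  shows "((Delta ^^ p) g \<longlongrightarrow> 0) at_top"
proof -
  have lim: "(\<lambda>n. (Delta ^^ p) g (real n)) \<longlonglongrightarrow> 0"
    using assms(1) by (simp add: D_class_def)
  obtain a where "p_convex_on p {a..} g \<or> p_convex_on p {a..} (\<lambda>x. - g x)"
    using assms(2) by (auto simp: K_class_def p_concave_on_iff_p_convex_on_minus)
  then show ?thesis
  proof
    assume "p_convex_on p {a..} g"
    from mono_on_tendsto_at_top_of_sequence[OF p_convex_on_imp_Delta_mono[OF this] lim]
    show ?thesis .
  next
    assume "p_convex_on p {a..} (\<lambda>x. - g x)"
    note mono = p_convex_on_imp_Delta_mono[OF this]
    have "((Delta ^^ p) (\<lambda>x. - g x) \<longlongrightarrow> 0) at_top"
      by (rule mono_on_tendsto_at_top_of_sequence[OF mono])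
         (use tendsto_minus[OF lim] in \<open>simp add: Delta_funpow_minus\<close>)
    from tendsto_minus[OF this] show ?thesis by (simp add: Delta_funpow_minus)
  qed
qed

section \<open>Convergence of the defining limit\<close>

definition Sigma_partial :: "nat \<Rightarrow> (real \<Rightarrow> real) \<Rightarrow> nat \<Rightarrow> real \<Rightarrow> real" where
  "Sigma_partial p g n x = - g x + (\<Sum>k=1..n-1. (g (real k) - g (x + real k)))
      + (\<Sum>j=1..p. (x gchoose j) * (Delta ^^ (j - 1)) g (real n))"

text \<open>
  The Newton polynomial of degree \<open>p\<close> interpolating \<open>g\<close> at \<open>n, \<dots>, n + p\<close>, minus \<open>g\<close>, both
  evaluated at \<open>n + x\<close>.
\<close>

definition Newton_error :: "nat \<Rightarrow> (real \<Rightarrow> real) \<Rightarrow> nat \<Rightarrow> real \<Rightarrow> real" where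
  "Newton_error p g n x = g (real n) - g (x + real n)
      + (\<Sum>j=1..p. (x gchoose j) * (Delta ^^ j) g (real n))"

lemma Sigma_partial_Suc:
  assumes "n \<ge> 1"
  shows "Sigma_partial p g (Suc n) x = Sigma_partial p g n x + Newton_error p g n x"
proof -
  have "(\<Sum>j=1..p. (x gchoose j) * (Delta ^^ (j - 1)) g (real (Suc n)))
      = (\<Sum>j=1..p. (x gchoose j) * (Delta ^^ (j - 1)) g (real n))
        + (\<Sum>j=1..p. (x gchoose j) * (Delta ^^ j) g (real n))"
    unfolding sum.distrib[symmetric]
  proof (rule sum.cong)
    fix j assume "j \<in> {1..p}"
    then obtain i where "j = Suc i" by (cases j) auto
    then show "(x gchoose j) * (Delta ^^ (j - 1)) g (real (Suc n))
        = (x gchoose j) * (Delta ^^ (j - 1)) g (real n) + (x gchoose j) * (Delta ^^ j) g (real n)"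
      by (simp add: Delta_def algebra_simps)
  qed simp
  moreover have "(\<Sum>k=1..n. (g (real k) - g (x + real k)))
      = (\<Sum>k=1..n-1. (g (real k) - g (x + real k))) + (g (real n) - g (x + real n))"
    using assms by (cases n) auto
  ultimately show ?thesis
    by (simp add: Sigma_partial_def Newton_error_def)
qed

lemma Sigma_partial_eq_sum_Newton_error:
  "Sigma_partial p g (Suc n) x = Sigma_partial p g 1 x + (\<Sum>k<n. Newton_error p g (Suc k) x)"
proof (induction n)
  case (Suc n)
  then show ?case using Sigma_partial_Suc[of "Suc n" p g x] by simp
qed simp

text \<open>
  The chord of \<open>g\<close> over \<open>[n, n + x]\<close> and \<open>\<Delta>g(n)\<close> both have slopes between those over
  \<open>[n - 1, n]\<close> and \<open>[n + m, n + m + 1]\<close>; below, the node is \<open>Suc n\<close>. A single bound in terms of \<open>\<Delta>\<^sup>pg\<close> also covers \<open>p = 0\<close>.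
\<close>

lemma Newton_error_bound_convex:
  assumes p: "p \<in> {0, 1}" and cvx: "p_convex_on p {a..} g"
    and n: "a \<le> real n" and x: "0 < x" "x \<le> real m"
  shows "\<bar>Newton_error p g (Suc n) x\<bar>
      \<le> real m * ((Delta ^^ p) g (real (n + Suc m)) - (Delta ^^ p) g (real n))"
proof (cases "p = 0")
  case True
  have mono: "mono_on {a..} g" using cvx True by (simp add: p_convex_on_def)
  have "g (real n) \<le> g (real (Suc n))" "g (real (Suc n)) \<le> g (x + real (Suc n))"
    "g (x + real (Suc n)) \<le> g (real (n + Suc m))"
    using n x by (intro mono_onD[OF mono]; simp)+
  then have "\<bar>Newton_error p g (Suc n) x\<bar> \<le> 1 * (g (real (n + Suc m)) - g (real n))"
    and "g (real n) \<le> g (real (n + Suc m))"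
    by (simp_all add: True Newton_error_def)
  moreover have "1 \<le> real m" using x by (cases m) auto
  ultimately show ?thesis
    using mult_right_mono[of 1 "real m" "g (real (n + Suc m)) - g (real n)"] True by simp
next
  case False
  then have p1: "p = 1" and g: "convex_on {a..} g"
    using p cvx by (auto simp: p_convex_on_def)
  define s where "s = (g (x + real (Suc n)) - g (real (Suc n))) / x"
  define L where "L = Delta g (real n)"
  define U where "U = Delta g (real (n + Suc m))"
  have m: "1 \<le> m" using x by (cases m) auto
  note slope = convex_on_chord_slope_mono[OF g]
  have "L \<le> s"
    using slope[of "real n" "real (Suc n)" "real (Suc n)" "x + real (Suc n)"] n x
    by (simp add: L_def s_def Delta_def add_ac)
  moreover have "s \<le> U"
    using slope[of "real (Suc n)" "x + real (Suc n)" "real (n + Suc m)" "real (n + Suc m) + 1"] n x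
    by (simp add: U_def s_def Delta_def add_ac)
  moreover have "L \<le> Delta g (real (Suc n))" "Delta g (real (Suc n)) \<le> U"
    using slope[of "real n" "real n + 1" "real (Suc n)" "real (Suc n) + 1"]
      slope[of "real (Suc n)" "real (Suc n) + 1" "real (n + Suc m)" "real (n + Suc m) + 1"] n m
    by (simp_all add: L_def U_def Delta_def)
  ultimately have "\<bar>Delta g (real (Suc n)) - s\<bar> \<le> U - L" and "0 \<le> U - L"
    by linarith+
  moreover have "Newton_error p g (Suc n) x = x * (Delta g (real (Suc n)) - s)"
    using x by (simp add: p1 Newton_error_def s_def field_simps)
  ultimately have "\<bar>Newton_error p g (Suc n) x\<bar> \<le> real m * (U - L)"
    using x by (auto simp: abs_mult intro!: mult_mono)
  then show ?thesis by (simp add: p1 L_def U_def)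
qed

lemma Newton_error_bound:
  assumes p: "p \<in> {0, 1}" and cvx: "p_convex_on p {a..} g \<or> p_concave_on p {a..} g"
    and n: "a \<le> real n" and x: "0 < x" "x \<le> real m"
  shows "\<bar>Newton_error p g (Suc n) x\<bar>
      \<le> real m * \<bar>(Delta ^^ p) g (real (n + Suc m)) - (Delta ^^ p) g (real n)\<bar>"
  using cvx
proof
  assume "p_convex_on p {a..} g"
  from Newton_error_bound_convex[OF p this n x] show ?thesis
    by (rule order_trans) (simp add: mult_left_mono)
next
  assume "p_concave_on p {a..} g"
  then have "p_convex_on p {a..} (\<lambda>x. - g x)"
    by (simp add: p_concave_on_iff_p_convex_on_minus)
  from Newton_error_bound_convex[OF p this n x]
  have "\<bar>Newton_error p (\<lambda>x. - g x) (Suc n) x\<bar>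
      \<le> real m * \<bar>(Delta ^^ p) g (real (n + Suc m)) - (Delta ^^ p) g (real n)\<bar>"
    by (rule order_trans) (auto simp: Delta_funpow_minus intro!: mult_left_mono)
  moreover have "Newton_error p (\<lambda>x. - g x) (Suc n) x = - Newton_error p g (Suc n) x"
    by (simp add: Newton_error_def Delta_funpow_minus sum_negf)
  ultimately show ?thesis by simp
qed

text \<open>
  A difference at distance \<open>m\<close> is a sum of \<open>m\<close> unit differences, and each of these
  telescopes over \<open>n\<close>; monotonicity makes the convergence absolute.
\<close>

lemma summable_abs_diff_of_mono:
  fixes h :: "real \<Rightarrow> real"
  assumes mono: "mono_on {a..} h" and lim: "(\<lambda>n. h (real n)) \<longlonglongrightarrow> l"
  shows "summable (\<lambda>n. \<bar>h (real (n + m)) - h (real n)\<bar>)"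
proof -
  have "summable (\<lambda>n. h (real (n + m)) - h (real n))"
  proof (induction m)
    case (Suc m)
    have "summable (\<lambda>n. h (real (Suc n + m)) - h (real (n + m)))"
      by (rule telescope_summable[OF LIMSEQ_ignore_initial_segment[OF lim, of m]])
    from summable_add[OF this Suc] show ?case by simp
  qed simp
  moreover have "\<forall>\<^sub>F n in sequentially.
      norm \<bar>h (real (n + m)) - h (real n)\<bar> \<le> h (real (n + m)) - h (real n)"
    using eventually_ge_at_top[of "nat \<lceil>a\<rceil>"]
  proof eventually_elim
    case (elim n)
    then have "a \<le> real n" by linarith
    then have "h (real n) \<le> h (real (n + m))" by (intro mono_onD[OF mono]) auto
    then show ?case by simp
  qed
  ultimately show ?thesis by (rule summable_comparison_test_ev[rotated])
qed

lemma summable_abs_Delta_funpow_diff: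
  assumes "g \<in> D_class p" "g \<in> K_class p"
  shows "summable (\<lambda>n. \<bar>(Delta ^^ p) g (real (n + m)) - (Delta ^^ p) g (real n)\<bar>)"
proof -
  have lim: "(\<lambda>n. (Delta ^^ p) g (real n)) \<longlonglongrightarrow> 0"
    using assms(1) by (simp add: D_class_def)
  obtain a where "p_convex_on p {a..} g \<or> p_convex_on p {a..} (\<lambda>x. - g x)"
    using assms(2) by (auto simp: K_class_def p_concave_on_iff_p_convex_on_minus)
  then show ?thesis
  proof
    assume "p_convex_on p {a..} g"
    from summable_abs_diff_of_mono[OF p_convex_on_imp_Delta_mono[OF this] lim]
    show ?thesis .
  next
    assume "p_convex_on p {a..} (\<lambda>x. - g x)"
    note mono = p_convex_on_imp_Delta_mono[OF this]
    have "(\<lambda>n. (Delta ^^ p) (\<lambda>x. - g x) (real n)) \<longlonglongrightarrow> 0"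
      using tendsto_minus[OF lim] by (simp add: Delta_funpow_minus)
    from summable_abs_diff_of_mono[OF mono this, of m]
    show ?thesis by (simp add: Delta_funpow_minus abs_minus_commute)
  qed
qed

lemma continuous_on_Sigma_partial_1:
  assumes "p \<in> {0, 1}" "continuous_on {0<..} g"
  shows "continuous_on {0<..} (Sigma_partial p g 1)"
  using assms by (auto simp: Sigma_partial_def[abs_def] intro!: continuous_intros)

lemma continuous_on_Newton_error:
  assumes p: "p \<in> {0, 1}" and g: "continuous_on {0<..} g"
  shows "continuous_on {0<..} (Newton_error p g n)"
proof -
  have "continuous_on {0<..} (\<lambda>x. g (x + real n))"
    by (rule continuous_on_compose2[OF g]) (auto intro!: continuous_intros)
  then show ?thesis
    using p by (auto simp: Newton_error_def[abs_def] intro!: continuous_intros)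
qed

text \<open>
  The Weierstrass test, with the summable bound from \<open>Newton_error_bound\<close>, gives existence
  of the limit and continuity at once.
\<close>

lemma Sigma_limit_and_continuity:
  assumes p: "p \<in> {0, 1}" and cont: "continuous_on {0<..} g"
    and D: "g \<in> D_class p" and K: "g \<in> K_class p"
  shows "\<And>x. x > 0 \<Longrightarrow> (\<lambda>n. Sigma_partial p g n x) \<longlonglongrightarrow> Sigma_fun p g x"
    and "continuous_on {0<..} (Sigma_fun p g)"
proof -
  obtain a where a: "p_convex_on p {a..} g \<or> p_concave_on p {a..} g"
    using K by (auto simp: K_class_def)
  define f where "f x = Sigma_partial p g 1 x + (\<Sum>k. Newton_error p g (Suc k) x)" for x
  have unif: "uniform_limit {0<..real m} (\<lambda>n x. \<Sum>k<n. Newton_error p g (Suc k) x)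
      (\<lambda>x. \<Sum>k. Newton_error p g (Suc k) x) sequentially" for m
  proof (rule Weierstrass_m_test_ev)
    show "summable (\<lambda>n. real m *
        \<bar>(Delta ^^ p) g (real (n + Suc m)) - (Delta ^^ p) g (real n)\<bar>)"
      by (intro summable_mult summable_abs_Delta_funpow_diff D K)
    show "\<forall>\<^sub>F n in sequentially. \<forall>x\<in>{0<..real m}. norm (Newton_error p g (Suc n) x)
        \<le> real m * \<bar>(Delta ^^ p) g (real (n + Suc m)) - (Delta ^^ p) g (real n)\<bar>"
      using eventually_ge_at_top[of "nat \<lceil>a\<rceil>"]
    proof eventually_elim
      case (elim n)
      then have "a \<le> real n" by linarith
      then show ?case using Newton_error_bound[OF p a] by auto
    qed
  qed
  have lim: "(\<lambda>n. Sigma_partial p g n x) \<longlonglongrightarrow> f x" if "x > 0" for x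
  proof -
    have "x \<in> {0<..real (nat \<lceil>x\<rceil>)}" using that by auto
    from tendsto_uniform_limitI[OF unif this]
    have "(\<lambda>n. Sigma_partial p g (Suc n) x) \<longlonglongrightarrow> f x"
      unfolding Sigma_partial_eq_sum_Newton_error f_def by (intro tendsto_intros)
    then show ?thesis by (rule LIMSEQ_imp_Suc)
  qed
  have Sigma_eq: "Sigma_fun p g x = f x" if "x > 0" for x
    using limI[OF lim[OF that]] by (simp add: Sigma_fun_def Sigma_partial_def)
  show "(\<lambda>n. Sigma_partial p g n x) \<longlonglongrightarrow> Sigma_fun p g x" if "x > 0" for x
    using lim[OF that] Sigma_eq[OF that] by simp
  \<comment> \<open>Uniformity holds only on bounded intervals, so continuity is obtained point by point
    from an interval containing the point in its interior.\<close>
  have "isCont f x" if "x > 0" for x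
  proof -
    define m where "m = Suc (nat \<lceil>x\<rceil>)"
    have x: "x \<in> {0<..<real m}" using that unfolding m_def by auto linarith
    have sub: "{0<..<real m} \<subseteq> {0<..}" by auto
    have "uniform_limit {0<..<real m} (\<lambda>n x. \<Sum>k<n. Newton_error p g (Suc k) x)
        (\<lambda>x. \<Sum>k. Newton_error p g (Suc k) x) sequentially"
      by (rule uniform_limit_on_subset[OF unif[of m]]) auto
    then have "continuous_on {0<..<real m} (\<lambda>x. \<Sum>k. Newton_error p g (Suc k) x)"
      by (rule uniform_limit_theorem[rotated])
        (auto intro!: continuous_intros always_eventually
          continuous_on_subset[OF continuous_on_Newton_error[OF p cont] sub])
    then have "continuous_on {0<..<real m} f"
      unfolding f_def
      by (intro continuous_intros continuous_on_subset[OF continuous_on_Sigma_partial_1[OF p cont] sub])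
    then show ?thesis using x by (simp add: continuous_on_eq_continuous_at)
  qed
  then have "continuous_on {0<..} f" by (simp add: continuous_on_eq_continuous_at)
  then show "continuous_on {0<..} (Sigma_fun p g)"
    using continuous_on_cong[of "{0<..}" "{0<..}" "Sigma_fun p g" f] Sigma_eq by auto
qed

section \<open>The difference equation and the shape of the solution\<close>

text \<open>
  The defect of \<open>f\<^sub>n\<close> in the difference equation is the difference of two null sequences, the
  Newton error (a term of a convergent series) and the term of degree \<open>p\<close> in the Newton
  polynomial.
\<close>

lemma Sigma_partial_shift:
  assumes p: "p \<in> {0, 1}" and n: "n \<ge> 1"
  shows "Sigma_partial p g n (x + 1) - Sigma_partial p g n x
      = g x + (Newton_error p g n x - (x gchoose p) * (Delta ^^ p) g (real n))"
proof -
  have "(\<Sum>k=1..n-1. g (real k) - g (x + 1 + real k))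
      = (\<Sum>k=1..n-1. g (real k) - g (x + real k)) + g (x + 1) - g (x + real n)"
    using n
  proof (induction n rule: nat_induct_at_least)
    case (Suc n)
    then obtain m where "n = Suc m" by (cases n) auto
    with Suc show ?case by (simp add: add_ac)
  qed simp
  then show ?thesis
    using p by (auto simp: Sigma_partial_def Newton_error_def algebra_simps)
qed

lemma Delta_Sigma_fun:
  assumes p: "p \<in> {0, 1}" and cont: "continuous_on {0<..} g"
    and D: "g \<in> D_class p" and K: "g \<in> K_class p" and x: "x > 0"
  shows "Delta (Sigma_fun p g) x = g x"
proof -
  note lim = Sigma_limit_and_continuity(1)[OF p cont D K]
  have "(\<lambda>n. Sigma_partial p g (Suc n) x - Sigma_partial p g n x) \<longlonglongrightarrow> 0"
    using tendsto_diff[OF LIMSEQ_Suc[OF lim[OF x]] lim[OF x]] by simp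
  moreover have ev: "\<forall>\<^sub>F n::nat in sequentially. n \<ge> 1" by (rule eventually_ge_at_top)
  then have "\<forall>\<^sub>F n in sequentially.
      Sigma_partial p g (Suc n) x - Sigma_partial p g n x = Newton_error p g n x"
    by eventually_elim (simp add: Sigma_partial_Suc)
  ultimately have err: "(\<lambda>n. Newton_error p g n x) \<longlonglongrightarrow> 0"
    by (rule Lim_transform_eventually)
  have "(\<lambda>n. (Delta ^^ p) g (real n)) \<longlonglongrightarrow> 0"
    using D by (simp add: D_class_def)
  from tendsto_add[OF tendsto_const[of "g x"] tendsto_diff[OF err tendsto_mult_left[OF this, of "x gchoose p"]]]
  have "(\<lambda>n. g x + (Newton_error p g n x - (x gchoose p) * (Delta ^^ p) g (real n))) \<longlonglongrightarrow> g x"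
    by simp
  moreover from ev have "\<forall>\<^sub>F n in sequentially.
      g x + (Newton_error p g n x - (x gchoose p) * (Delta ^^ p) g (real n))
      = Sigma_partial p g n (x + 1) - Sigma_partial p g n x"
    by eventually_elim (simp add: Sigma_partial_shift[OF p])
  ultimately have "(\<lambda>n. Sigma_partial p g n (x + 1) - Sigma_partial p g n x) \<longlonglongrightarrow> g x"
    by (rule Lim_transform_eventually)
  moreover have "(\<lambda>n. Sigma_partial p g n (x + 1) - Sigma_partial p g n x) \<longlonglongrightarrow>
      Sigma_fun p g (x + 1) - Sigma_fun p g x"
    using x by (intro tendsto_diff lim) auto
  ultimately show ?thesis by (simp add: Delta_def LIMSEQ_unique)
qed

text \<open>
  Up to an additive constant, and for \<open>p = 1\<close> a linear function, \<open>- f\<^sub>n\<close> is a sum of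
  translates of \<open>g\<close> to the left, which stay \<open>p\<close>-convex on the same half-line.
\<close>

lemma Sigma_partial_p_convex:
  assumes p: "p \<in> {0, 1}" and cvx: "p_convex_on p {x..} g"
  shows "p_convex_on p {x..} (\<lambda>y. - Sigma_partial p g n y)"
proof (cases "p = 0")
  case True
  then have mono: "mono_on {x..} g" using cvx by (simp add: p_convex_on_def)
  have "Sigma_partial p g n z \<le> Sigma_partial p g n y" if "x \<le> y" "y \<le> z" for y z
  proof -
    have le: "g (y + real k) \<le> g (z + real k)" for k
      using that by (intro mono_onD[OF mono]) auto
    have "(\<Sum>k=1..n-1. g (real k) - g (z + real k)) \<le> (\<Sum>k=1..n-1. g (real k) - g (y + real k))"
      by (intro sum_mono diff_left_mono le)
    then show ?thesis
      using le[of 0] by (simp add: Sigma_partial_def True)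
  qed
  then show ?thesis by (auto simp: True p_convex_on_def intro!: mono_onI)
next
  case False
  then have p1: "p = 1" and g: "convex_on {x..} g"
    using p cvx by (auto simp: p_convex_on_def)
  have "- Sigma_partial p g n (u *\<^sub>R y + v *\<^sub>R z)
      \<le> u * - Sigma_partial p g n y + v * - Sigma_partial p g n z"
    if yz: "x \<le> y" "x \<le> z" and uv: "0 \<le> u" "0 \<le> v" "u + v = 1" for y z u v
  proof -
    have conv: "g (u * y + v * z + real k) \<le> u * g (y + real k) + v * g (z + real k)" for k
    proof -
      have "u * (y + real k) + v * (z + real k) = u * y + v * z + (u + v) * real k"
        by (simp add: algebra_simps)
      then have eq: "u * (y + real k) + v * (z + real k) = u * y + v * z + real k"
        using uv by simp
      have "g (u *\<^sub>R (y + real k) + v *\<^sub>R (z + real k)) \<le> u * g (y + real k) + v * g (z + real k)"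
        using g yz uv unfolding convex_on_def by auto
      then show ?thesis by (simp add: eq)
    qed
    have "(\<Sum>k=1..n-1. g (u * y + v * z + real k) - g (real k))
        \<le> (\<Sum>k=1..n-1. u * (g (y + real k) - g (real k)) + v * (g (z + real k) - g (real k)))"
    proof (rule sum_mono)
      fix k
      have "u * g (real k) + v * g (real k) = g (real k)"
        using uv by (metis distrib_right mult_1)
      then show "g (u * y + v * z + real k) - g (real k)
          \<le> u * (g (y + real k) - g (real k)) + v * (g (z + real k) - g (real k))"
        using conv[of k] by (simp add: right_diff_distrib)
    qed
    also have "\<dots> = u * (\<Sum>k=1..n-1. g (y + real k) - g (real k))
        + v * (\<Sum>k=1..n-1. g (z + real k) - g (real k))"
      by (simp add: sum.distrib sum_distrib_left)
    finally have sums: "(\<Sum>k=1..n-1. g (u * y + v * z + real k) - g (real k))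
        \<le> u * (\<Sum>k=1..n-1. g (y + real k) - g (real k))
        + v * (\<Sum>k=1..n-1. g (z + real k) - g (real k))" .
    have neg: "- Sigma_partial p g n w
        = g w + (\<Sum>k=1..n-1. g (w + real k) - g (real k)) - w * g (real n)" for w
      by (simp add: p1 Sigma_partial_def sum_subtractf)
    show ?thesis unfolding neg
      using sums conv[of 0] by (simp add: algebra_simps)
  qed
  then show ?thesis by (auto simp: p1 p_convex_on_def convex_on_def)
qed

lemma p_convex_on_LIMSEQ:
  assumes "\<And>n. p_convex_on p I (F n)" and lim: "\<And>y. y \<in> I \<Longrightarrow> (\<lambda>n. F n y) \<longlonglongrightarrow> f y"
  shows "p_convex_on p I f"
proof (cases "p = 0")
  case True
  have "F n y \<le> F n z" if "y \<in> I" "z \<in> I" "y \<le> z" for n y z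
    using assms(1)[of n] that by (auto simp: True p_convex_on_def monotone_on_def)
  then show ?thesis
    unfolding p_convex_on_def
    by (intro disjI1 conjI True mono_onI LIMSEQ_le[OF lim lim]) auto
next
  case False
  then have p: "p = 1" and cvx: "\<And>n. convex_on I (F n)"
    using assms(1) by (auto simp: p_convex_on_def)
  have I: "convex I" using cvx by (auto simp: convex_on_def)
  have "f (u *\<^sub>R y + v *\<^sub>R z) \<le> u * f y + v * f z"
    if "y \<in> I" "z \<in> I" "0 \<le> u" "0 \<le> v" "u + v = 1" for y z u v
  proof (rule LIMSEQ_le)
    show "(\<lambda>n. F n (u *\<^sub>R y + v *\<^sub>R z)) \<longlonglongrightarrow> f (u *\<^sub>R y + v *\<^sub>R z)"
      by (intro lim convexD[OF I] that)
    show "(\<lambda>n. u * F n y + v * F n z) \<longlonglongrightarrow> u * f y + v * f z"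
      by (intro tendsto_intros lim that)
    show "\<exists>N. \<forall>n\<ge>N. F n (u *\<^sub>R y + v *\<^sub>R z) \<le> u * F n y + v * F n z"
      using cvx that by (auto simp: convex_on_def)
  qed
  then show ?thesis using I by (auto simp: p p_convex_on_def convex_on_def)
qed

lemma Sigma_fun_p_convex:
  assumes p: "p \<in> {0, 1}" and cont: "continuous_on {0<..} g"
    and D: "g \<in> D_class p" and K: "g \<in> K_class p" and x: "x > 0"
  shows "p_convex_on p {x..} g \<Longrightarrow> p_concave_on p {x..} (Sigma_fun p g)"
    and "p_concave_on p {x..} g \<Longrightarrow> p_convex_on p {x..} (Sigma_fun p g)"
proof -
  note lim = Sigma_limit_and_continuity(1)[OF p cont D K]
  show "p_concave_on p {x..} (Sigma_fun p g)" if "p_convex_on p {x..} g"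
    unfolding p_concave_on_iff_p_convex_on_minus
    by (rule p_convex_on_LIMSEQ[OF Sigma_partial_p_convex[OF p that]])
       (use x in \<open>auto intro!: tendsto_minus lim\<close>)
  show "p_convex_on p {x..} (Sigma_fun p g)" if "p_concave_on p {x..} g"
  proof (rule p_convex_on_LIMSEQ)
    have "p_convex_on p {x..} (\<lambda>y. - g y)"
      using that by (simp add: p_concave_on_iff_p_convex_on_minus)
    from Sigma_partial_p_convex[OF p this]
    have "p_convex_on p {x..} (\<lambda>y. - Sigma_partial p (\<lambda>y. - g y) n y)" for n .
    moreover have "- Sigma_partial p (\<lambda>y. - g y) n y = Sigma_partial p g n y" for n y
      by (simp add: Sigma_partial_def Delta_funpow_minus sum_negf sum_subtractf)
    ultimately show "p_convex_on p {x..} (Sigma_partial p g n)" for n by simp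
  qed (use x in \<open>auto intro!: lim\<close>)
qed

section \<open>Midpoint and trapezoidal errors\<close>

lemma integral_affine:
  fixes a b c d e :: real
  assumes "a \<le> b"
  shows "integral {a..b} (\<lambda>t. c * (t - d) + e)
      = (b - a) * (c * ((a + b) / 2 - d) + e)"
proof (rule integral_unique)
  define F where "F t = c * (t\<^sup>2 / 2 - d * t) + e * t" for t
  have "((\<lambda>t. c * (t - d) + e) has_integral F b - F a) {a..b}"
    by (rule fundamental_theorem_of_calculus[OF assms])
       (auto simp: F_def has_real_derivative_iff_has_vector_derivative[symmetric]
         intro!: derivative_eq_intros)
  also have "F b - F a = (b - a) * (c * ((a + b) / 2 - d) + e)"
    by (simp add: F_def power2_eq_square field_simps)
  finally show "((\<lambda>t. c * (t - d) + e) has_integral (b - a) * (c * ((a + b) / 2 - d) + e)) {a..b}" .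
qed

lemma integrable_affine: "(\<lambda>t::real. c * (t - d) + e :: real) integrable_on {a..b}"
  by (intro integrable_continuous_real continuous_intros)

lemma convex_on_integral_le_trapezoid:
  fixes f :: "real \<Rightarrow> real"
  assumes "a < b" "convex_on {a..b} f" "f integrable_on {a..b}"
  shows "integral {a..b} f \<le> (b - a) * ((f a + f b) / 2)"
proof -
  have "integral {a..b} f \<le> integral {a..b} (\<lambda>t. (f b - f a) / (b - a) * (t - a) + f a)"
    using assms by (intro integral_le integrable_affine convex_onD_Icc') auto
  also have "\<dots> = (b - a) * ((f a + f b) / 2)"
    using assms(1) by (subst integral_affine) (simp_all add: field_simps)
  finally show ?thesis .
qed

text \<open>Averaging \<open>f\<close> with its reflection in the midpoint leaves the integral unchanged and
  does not go below the value at the midpoint.\<close>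

lemma convex_on_midpoint_le_integral:
  fixes f :: "real \<Rightarrow> real"
  assumes "a \<le> b" "convex_on {a..b} f" "f integrable_on {a..b}"
  shows "(b - a) * f ((a + b) / 2) \<le> integral {a..b} f"
proof -
  have "((\<lambda>t. f (- t)) has_integral integral {a..b} f) {- b..- a}"
    using assms(3) by (simp add: has_integral_integral)
  then have refl: "((\<lambda>t. f (a + b - t)) has_integral integral {a..b} f) {a..b}"
    using has_integral_shift_cbox[of "\<lambda>t. f (- t)" "integral {a..b} f" "- b" "- a" "- (a + b)"]
    by (simp add: algebra_simps)
  have avg: "((\<lambda>t. (f t + f (a + b - t)) / 2) has_integral
      (integral {a..b} f + integral {a..b} f) / 2) {a..b}"
    by (intro has_integral_divide has_integral_add refl integrable_integral assms(3))
  have const: "((\<lambda>t. f ((a + b) / 2)) has_integral (b - a) * f ((a + b) / 2)) {a..b}"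
    using has_integral_const_real[of "f ((a + b) / 2)" a b] assms(1) by simp
  have "f ((a + b) / 2) \<le> (f t + f (a + b - t)) / 2" if "t \<in> {a..b}" for t
  proof -
    have "f ((1 - 1/2) *\<^sub>R t + (1/2) *\<^sub>R (a + b - t)) \<le> (1 - 1/2) * f t + 1/2 * f (a + b - t)"
      using that by (intro convex_onD[OF assms(2)]) auto
    then show ?thesis by (simp add: field_simps)
  qed
  from has_integral_le[OF const avg this] show ?thesis by simp
qed

lemma Gregory_0: "Gregory 0 = 1"
  by (simp add: Gregory_def)

lemma Gregory_1: "Gregory 1 = 1 / 2"
  using integral_affine[of 0 1 1 0 0] by (simp add: Gregory_def)

text \<open>
  With \<open>M = f (x + 1/2)\<close>, the left half of the integral lies between \<open>f x / 2\<close> and \<open>M / 2\<close>, and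
  the right half between \<open>M / 2\<close> and \<open>f (x + 1) / 2\<close>. So the integral minus \<open>M\<close> is at least
  half of \<open>f x - M\<close>, and exceeds \<open>f x\<close> by at least half of \<open>M - f x\<close>.
\<close>

lemma mono_on_midpoint_error:
  assumes mono: "mono_on {x..} f" and int: "f integrable_on {x..x + 1}"
  shows "\<bar>f (x + 1/2) - integral {x..x + 1} f\<bar> \<le> \<bar>J_fun 1 f x\<bar>
    \<and> \<bar>J_fun 1 f x\<bar> \<le> \<bar>Delta f x\<bar>"
proof -
  define I where "I = integral {x..x + 1/2} f"
  define J where "J = integral {x + 1/2..x + 1} f"
  have sum: "integral {x..x + 1} f = I + J"
    unfolding I_def J_def using int by (intro Henstock_Kurzweil_Integration.integral_combine[symmetric]) auto
  have sub: "f integrable_on {x..x + 1/2}" "f integrable_on {x + 1/2..x + 1}"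
    by (rule integrable_on_subinterval[OF int]; auto)+
  have const: "integral {a..b} (\<lambda>_. c) = (b - a) * c" if "a \<le> b" for a b c :: real
    using that by simp
  have lo: "(b - a) * c \<le> integral {a..b} f"
    if "a \<le> b" "f integrable_on {a..b}" "\<And>t. t \<in> {a..b} \<Longrightarrow> c \<le> f t" for a b c
    using integral_le[of "\<lambda>_. c" "{a..b}" f] that const by auto
  have hi: "integral {a..b} f \<le> (b - a) * c"
    if "a \<le> b" "f integrable_on {a..b}" "\<And>t. t \<in> {a..b} \<Longrightarrow> f t \<le> c" for a b c
    using integral_le[of f "{a..b}" "\<lambda>_. c"] that const by auto
  have "f x / 2 \<le> I" "f (x + 1/2) / 2 \<le> J" "J \<le> f (x + 1) / 2" "I \<le> f (x + 1/2) / 2"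
    unfolding I_def J_def
    using lo[OF _ sub(1), of "f x"] lo[OF _ sub(2), of "f (x + 1/2)"]
      hi[OF _ sub(2), of "f (x + 1)"] hi[OF _ sub(1), of "f (x + 1/2)"]
    by (auto simp: mono_onD[OF mono])
  moreover have "f x \<le> f (x + 1/2)" "f (x + 1/2) \<le> f (x + 1)"
    by (auto intro!: mono_onD[OF mono])
  ultimately show ?thesis
    by (auto simp: J_fun_def Gregory_0 Delta_def sum abs_if)
qed

text \<open>
  Adding the trapezoidal bounds on the two halves shows that twice the integral is at most
  midpoint plus trapezoidal value, so the trapezoidal error dominates. It is itself bounded
  through the line extending the chord over \<open>[x + 1, x + 2]\<close> to the left, which stays below \<open>f\<close>.
\<close>

lemma convex_on_midpoint_error:
  assumes cvx: "convex_on {x..} f" and int: "f integrable_on {x..x + 1}"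
  shows "\<bar>f (x + 1/2) - integral {x..x + 1} f\<bar> \<le> \<bar>J_fun 2 f x\<bar>
    \<and> \<bar>J_fun 2 f x\<bar> \<le> \<bar>Delta (Delta f) x\<bar> / 2"
proof -
  define I where "I = integral {x..x + 1/2} f"
  define J where "J = integral {x + 1/2..x + 1} f"
  have sum: "integral {x..x + 1} f = I + J"
    unfolding I_def J_def using int by (intro Henstock_Kurzweil_Integration.integral_combine[symmetric]) auto
  have sub: "f integrable_on {x..x + 1/2}" "f integrable_on {x + 1/2..x + 1}"
    by (rule integrable_on_subinterval[OF int]; auto)+
  have cvx': "convex_on {a..b} f" if "x \<le> a" for a b
    using that by (intro convex_on_subset[OF cvx]) auto
  have "I \<le> (f x + f (x + 1/2)) / 4" "J \<le> (f (x + 1/2) + f (x + 1)) / 4"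
    unfolding I_def J_def
    using convex_on_integral_le_trapezoid[OF _ cvx' sub(1)]
      convex_on_integral_le_trapezoid[OF _ cvx' sub(2)] by auto
  moreover have "I + J \<le> (f x + f (x + 1)) / 2"
    using convex_on_integral_le_trapezoid[OF _ cvx' int] by (simp add: sum)
  moreover have "f (x + 1/2) \<le> I + J"
    using convex_on_midpoint_le_integral[OF _ cvx' int] by (simp add: sum add_divide_distrib)
  moreover have "f (x + 1) - (f (x + 2) - f (x + 1)) / 2 \<le> I + J"
  proof -
    have "integral {x..x + 1} (\<lambda>t. (f (x + 2) - f (x + 1)) * (t - (x + 1)) + f (x + 1))
        \<le> integral {x..x + 1} f"
    proof (rule integral_le[OF integrable_affine int])
      fix t assume t: "t \<in> {x..x + 1}"
      show "(f (x + 2) - f (x + 1)) * (t - (x + 1)) + f (x + 1) \<le> f t"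
      proof (cases "t = x + 1")
        case False
        with t have "(f (x + 1) - f t) / (x + 1 - t) \<le> (f (x + 2) - f (x + 1)) / (x + 2 - (x + 1))"
          by (intro convex_on_chord_slope_mono[OF cvx]) auto
        then have "f (x + 1) - f t \<le> (f (x + 2) - f (x + 1)) * (x + 1 - t)"
          using t False by (simp add: pos_divide_le_eq)
        then show ?thesis by (simp add: algebra_simps)
      qed simp
    qed
    then show ?thesis
      unfolding sum by (subst (asm) integral_affine) (simp_all add: field_simps)
  qed
  moreover have "J_fun 2 f x = (f x + f (x + 1)) / 2 - integral {x..x + 1} f"
    by (simp add: J_fun_def numeral_2_eq_2 Gregory_0 Gregory_1[unfolded One_nat_def]
        Delta_def field_simps)
  then have "J_fun 2 f x = (f x + f (x + 1)) / 2 - (I + J)" by (simp only: sum)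
  moreover have "Delta (Delta f) x = f (x + 2) - 2 * f (x + 1) + f x"
    by (simp add: Delta_def add_ac)
  ultimately have "\<bar>f (x + 1/2) - (I + J)\<bar> \<le> J_fun 2 f x"
    and "0 \<le> J_fun 2 f x" and "J_fun 2 f x \<le> Delta (Delta f) x / 2"
    by (simp_all add: abs_le_iff field_simps)
  then show ?thesis unfolding sum by auto
qed

lemma p_convex_on_midpoint_error:
  assumes p: "p \<in> {0, 1}" and int: "f integrable_on {x..x + 1}"
    and "p_convex_on p {x..} f \<or> p_concave_on p {x..} f"
  shows "\<bar>f (x + 1/2) - integral {x..x + 1} f\<bar> \<le> \<bar>J_fun (p + 1) f x\<bar>
    \<and> \<bar>J_fun (p + 1) f x\<bar> \<le> Gregory_bar p * \<bar>(Delta ^^ Suc p) f x\<bar>"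
proof -
  have convex_case: "\<bar>f (x + 1/2) - integral {x..x + 1} f\<bar> \<le> \<bar>J_fun (p + 1) f x\<bar>
    \<and> \<bar>J_fun (p + 1) f x\<bar> \<le> Gregory_bar p * \<bar>(Delta ^^ Suc p) f x\<bar>"
    if "f integrable_on {x..x + 1}" "p_convex_on p {x..} f" for f
  proof (cases "p = 0")
    case True
    then show ?thesis
      using mono_on_midpoint_error[of x f] that by (simp add: p_convex_on_def Gregory_bar_def)
  next
    case False
    then have "p = 1" using p by simp
    then show ?thesis
      using convex_on_midpoint_error[of x f] that
      by (simp add: p_convex_on_def Gregory_bar_def Gregory_1[unfolded One_nat_def] numeral_2_eq_2)
  qed
  have J_minus: "J_fun q (\<lambda>x. - f x) x = - J_fun q f x" for q
    by (simp add: J_fun_def Delta_funpow_minus sum_negf)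
  show ?thesis using assms(3)
  proof
    assume "p_convex_on p {x..} f"
    then show ?thesis by (rule convex_case[OF int])
  next
    assume "p_concave_on p {x..} f"
    then have "p_convex_on p {x..} (\<lambda>x. - f x)"
      by (simp add: p_concave_on_iff_p_convex_on_minus)
    from convex_case[OF integrable_neg[OF int] this] show ?thesis
      unfolding J_minus Delta_funpow_minus integral_neg by (simp add: abs_minus_commute)
  qed
qed

section \<open>Integrating the difference equation\<close>

text \<open>Sliding the window \<open>[1, 2]\<close> to \<open>[y, y + 1]\<close> changes the integral of \<open>f\<close> at the rate \<open>\<Delta>f\<close>.\<close>

lemma integral_unit_window:
  assumes cont: "continuous_on {0<..} f" and Delta: "\<And>x. x > 0 \<Longrightarrow> Delta f x = g x"
    and y: "y \<ge> 1"
  shows "integral {y..y + 1} f = integral {0..1} (\<lambda>t. f (t + 1)) + integral {1..y} g"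
proof -
  have int: "f integrable_on {a..b}" if "a > 0" for a b
    using that by (intro integrable_continuous_real continuous_on_subset[OF cont]) auto
  have shift: "integral {a..b} (\<lambda>t. f (t + 1)) = integral {a + 1..b + 1} f" for a b
    using integral_shift_Icc_real[of a b f 1] by (simp add: o_def add.commute)
  have int1: "(\<lambda>t. f (t + 1)) integrable_on {1..y}"
    by (intro integrable_continuous_real continuous_on_compose2[OF cont] continuous_intros) auto
  have "integral {1..y} g = integral {1..y} (\<lambda>t. f (t + 1) - f t)"
    by (rule integral_cong) (use Delta in \<open>auto simp: Delta_def\<close>)
  also have "\<dots> = integral {2..y + 1} f - integral {1..y} f"
    using integral_diff[OF int1 int[of 1 y]] shift[of 1 y] by simp
  finally have "integral {1..y} g = integral {2..y + 1} f - integral {1..y} f" .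
  moreover have "integral {1..2} f + integral {2..y + 1} f = integral {1..y + 1} f"
    "integral {1..y} f + integral {y..y + 1} f = integral {1..y + 1} f"
    using y by (auto intro!: Henstock_Kurzweil_Integration.integral_combine int)
  moreover have "integral {0..1} (\<lambda>t. f (t + 1)) = integral {1..2} f"
    using shift[of 0 1] by simp
  ultimately show ?thesis by simp
qed

section \<open>Error bounds and asymptotics of the indefinite sum\<close>

theorem proposition6p19:
  fixes p :: nat and g :: "real \<Rightarrow> real"
  assumes "p \<in> {0, 1}"
    and "continuous_on {0<..} g"
    and "g \<in> D_class p"
    and "g \<in> K_class p"
  shows "(\<forall>x>0. p_convex_on p {x..} g \<or> p_concave_on p {x..} g \<longrightarrow>
            \<bar>Sigma_fun p g (x + 1/2) - integral {x..x + 1} (Sigma_fun p g)\<bar>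
              \<le> \<bar>J_fun (p + 1) (Sigma_fun p g) x\<bar>
          \<and> \<bar>J_fun (p + 1) (Sigma_fun p g) x\<bar>
              \<le> Gregory_bar p * \<bar>(Delta ^^ p) g x\<bar>)
       \<and> ((\<lambda>x. Sigma_fun p g x - integral {x - 1/2..x + 1/2} (Sigma_fun p g)) \<longlongrightarrow> 0) at_top
       \<and> ((\<lambda>x. Sigma_fun p g x - integral {1..x - 1/2} g) \<longlongrightarrow> asym_const p g) at_top"
proof -
  define f where "f = Sigma_fun p g"
  note cont = Sigma_limit_and_continuity(2)[OF assms, folded f_def]
  note Delta_f = Delta_Sigma_fun[OF assms, folded f_def]
  have Delta_pow: "(Delta ^^ Suc p) f x = (Delta ^^ p) g x" if "x > 0" for x
    using assms(1) Delta_f[of x] Delta_f[of "x + 1"] that by (auto simp: Delta_def)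
  have bounds: "\<bar>f (x + 1/2) - integral {x..x + 1} f\<bar> \<le> \<bar>J_fun (p + 1) f x\<bar>
      \<and> \<bar>J_fun (p + 1) f x\<bar> \<le> Gregory_bar p * \<bar>(Delta ^^ p) g x\<bar>"
    if x: "x > 0" and g: "p_convex_on p {x..} g \<or> p_concave_on p {x..} g" for x
  proof -
    have "f integrable_on {x..x + 1}"
      using x by (intro integrable_continuous_real continuous_on_subset[OF cont]) auto
    moreover have "p_convex_on p {x..} f \<or> p_concave_on p {x..} f"
      using Sigma_fun_p_convex[OF assms x, folded f_def] g by blast
    ultimately show ?thesis
      using p_convex_on_midpoint_error[OF assms(1)] Delta_pow[OF x] by metis
  qed
  obtain a where a: "a > 0" "p_convex_on p {a..} g \<or> p_concave_on p {a..} g"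
    using assms(4) by (auto simp: K_class_def)
  have restrict: "p_convex_on p {x..} g \<or> p_concave_on p {x..} g" if "a \<le> x" for x
  proof -
    have "{x..} \<subseteq> {a..}" using that by auto
    then show ?thesis
      using a(2) by (auto simp: p_convex_on_def p_concave_on_def concave_on_def
          intro: monotone_on_subset convex_on_subset)
  qed
  have shift: "filterlim (\<lambda>x::real. x - 1/2) at_top at_top"
    using filterlim_tendsto_add_at_top[OF tendsto_const[of "- 1/2 :: real"] filterlim_ident]
    by simp
  have lim: "((\<lambda>x. f x - integral {x - 1/2..x + 1/2} f) \<longlongrightarrow> 0) at_top"
  proof (rule Lim_null_comparison)
    show "\<forall>\<^sub>F x in at_top. norm (f x - integral {x - 1/2..x + 1/2} f)
        \<le> Gregory_bar p * \<bar>(Delta ^^ p) g (x - 1/2)\<bar>"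
      using eventually_ge_at_top[of "a + 1/2"]
    proof eventually_elim
      case (elim x)
      then show ?case
        using bounds[of "x - 1/2", OF _ restrict] a(1) by (auto simp: add.commute)
    qed
    have "((\<lambda>x. (Delta ^^ p) g (x - 1/2)) \<longlongrightarrow> 0) at_top"
      by (rule filterlim_compose[OF Delta_funpow_tendsto_0[OF assms(3,4)] shift])
    from tendsto_mult_right_zero[OF tendsto_rabs_zero[OF this]]
    show "((\<lambda>x. Gregory_bar p * \<bar>(Delta ^^ p) g (x - 1/2)\<bar>) \<longlongrightarrow> 0) at_top" .
  qed
  have "((\<lambda>x. f x - integral {1..x - 1/2} g) \<longlongrightarrow> asym_const p g) at_top"
  proof (rule Lim_transform_eventually)
    show "((\<lambda>x. f x - integral {x - 1/2..x + 1/2} f + asym_const p g) \<longlongrightarrow> asym_const p g) at_top"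
      using tendsto_add[OF lim tendsto_const] by simp
    show "\<forall>\<^sub>F x in at_top. f x - integral {x - 1/2..x + 1/2} f + asym_const p g
        = f x - integral {1..x - 1/2} g"
      using eventually_ge_at_top[of "3/2 :: real"]
    proof eventually_elim
      case (elim x)
      have "x - 1/2 + 1 = x + 1/2" by simp
      then have "integral {x - 1/2..x + 1/2} f = asym_const p g + integral {1..x - 1/2} g"
        using integral_unit_window[OF cont Delta_f, of "x - 1/2"] elim
        by (simp only: asym_const_def f_def)
      then show ?case by simp
    qed
  qed
  with bounds lim show ?thesis unfolding f_def by blast
qed

end
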